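(* Let $K\subset\mathbb R^n$ be a convex body with $0\in\operatorname{int}(K)$ and let $K^\circ$ be its polar convex body. Let $\mathcal C_K:\mathcal F_K\to\mathcal E_{K^\circ}$ and $\mathcal C_{K^\circ}:\mathcal F_{K^\circ}\to\mathcal E_K$ be the conjugate face maps. Then: (i) $\mathcal C_K$ restricts to a surjective map $$\mathcal F_K\setminus\mathcal E_K\;\to\;\{F\in\mathcal E_{K^\circ}\mid F\text{ has an incomplete normal cone}\}.$$ (ii) $\mathcal C_K$ restricts further to a surjective map with range $\mathcal C_K(\mathcal F_K\setminus\mathcal E_K)$ and with domain equal to the set of those non-exposed faces of $K$ which are coatoms of $\mathcal F_K(F)$ for some exposed face $F$ of $K$. (iii) The preimage of $F\in\mathcal E_{K^\circ}$ under $\mathcal C_K$ is $\mathcal C_K^{-1}(F)=\mathrm{cl}_{\mathcal E}^{-1}(\mathcal C_{K^\circ}(F))$, where $\mathrm{cl}_{\mathcal E}:\mathcal F_K\to\mathcal E_K$ is the exposed closure.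
   Context: $\mathbb R^n$ ($n\ge 1$) carries the standard scalar product. A convex body is a compact convex set. The polar of $K$ is $K^\circ=\{u\in\mathbb R^n\mid\langle u,v\rangle\le 1\ \forall v\in K\}$; it is a convex body with $0\in\operatorname{int}(K^\circ)$ and $(K^\circ)^\circ=K$. Faces. For a convex set $C\subset\mathbb R^n$, a face of $C$ is a convex subset $F\subset C$ such that $x,y,z\in C$, $y\in F$ and $y\in\,]x,z[\,=\{(1-\lambda)x+\lambda z\mid 0<\lambda<1\}$ imply $x,z\in F$. Put $h_C(u)=\sup\{\langle x,u\rangle\mid x\in C\}$ and, for $u\ne 0$, $H_C(u)=\{x\in\mathbb R^n\mid\langle x,u\rangle=h_C(u)\}$. The exposed faces of $C$ are the non-empty sets of the form $C\cap H_C(u)$, $u\neq 0$, together with $\emptyset$ and $C$. A face that is not exposed is called non-exposed. $\mathcal F_C$ and $\mathcal E_C\subset\mathcal F_C$ denote the sets of faces and of exposed faces of $C$, ordered by inclusion; both are complete lattices with intersection as infimum. Normal cones. The normal cone of $C$ at $x\in C$ is $N(x)=\{u\in\mathbb R^n\mid\langle u,y-x\rangle\le 0\ \forall y\in C\}$; the whole space $\mathbb R^n$ is also a normal cone by definition. A touching cone of $C$ is any non-empty face of any normal cone of $C$. $\mathcal N_C\subset\mathcal T_C$ denote the sets of normal cones and touching cones, ordered by inclusion. The normal cone of a face $F$ of $C$ is $\Psi(F):=N(x)$ for any $x$ in the relative interior of $F$ if $F\ne\emptyset$ (independent of $x$), and $\Psi(\emptyset):=\mathbb R^n$. Conjugate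 faces. $\mathcal C_K(F)=\{v\in K^\circ\mid\langle v,u\rangle=1\ \forall u\in F\}$ for $F\in\mathcal F_K$, and analogously $\mathcal C_{K^\circ}$ for faces of $K^\circ$ (with $(K^\circ)^\circ=K$). Exposed closure. $\mathrm{cl}_{\mathcal E}(F)$ is the intersection of all exposed faces of $K$ containing the face $F$. Coatoms. In a poset $L$ with greatest element $1$, an element $x\ne 1$ is a coatom if for all $y\in L$, $x\le y$ and $y\neq1$ imply $y=x$. Complete normal cones. For a normal cone $N\in\mathcal N_{C}$ (with $C=K$ or $C=K^\circ$) let $\mathcal T_{C}(N)=\{T\in\mathcal T_{C}\mid T\subset N\}$, which has greatest element $N$. $N$ is complete if all coatoms of $\mathcal T_{C}(N)$ are normal cones of $C$; otherwise $N$ is incomplete. An exposed face $F$ of $K^\circ$ has an incomplete normal cone if $\Psi(F)\in\mathcal N_{K^\circ}$ is incomplete. For an exposed face $F$ of $K$, $\mathcal F_K(F)=\{G\in\mathcal F_K\mid G\subset F\}$ (with greatest element $F$). *)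

theory Defs
  imports "HOL-Analysis.Analysis"
begin

definition polar :: "'a::euclidean_space set \<Rightarrow> 'a set" where
  "polar K = {u. \<forall>v\<in>K. u \<bullet> v \<le> 1}"

definition faces :: "'a::euclidean_space set \<Rightarrow> 'a set set" where
  "faces C = {F. F face_of C}"

text \<open>The library notion of exposed face admits the zero functional; this contributes exactly
  the empty set and \<open>C\<close> itself (cf. the lemma \<open>exposed_face_of\<close>).\<close>

definition exposed_faces :: "'a::euclidean_space set \<Rightarrow> 'a set set" where
  "exposed_faces C = {F. F exposed_face_of C}"

definition normal_cone :: "'a::euclidean_space set \<Rightarrow> 'a \<Rightarrow> 'a set" where
  "normal_cone C x = {u. \<forall>y\<in>C. u \<bullet> (y - x) \<le> 0}"

definition normal_cones :: "'a::euclidean_space set \<Rightarrow> 'a set set" where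
  "normal_cones C = insert UNIV (normal_cone C ` C)"

definition touching_cones :: "'a::euclidean_space set \<Rightarrow> 'a set set" where
  "touching_cones C = {T. T \<noteq> {} \<and> (\<exists>N\<in>normal_cones C. T face_of N)}"

definition face_normal_cone :: "'a::euclidean_space set \<Rightarrow> 'a set \<Rightarrow> 'a set" where
  "face_normal_cone C F =
     (if F = {} then UNIV else normal_cone C (SOME x. x \<in> rel_interior F))"

text \<open>The normal cone of a non-empty face does not depend on the chosen point.\<close>

lemma face_normal_cone_eq:
  fixes C :: "'a::euclidean_space set"
  assumes "F face_of C" and x: "x \<in> rel_interior F"
  shows "face_normal_cone C F = normal_cone C x"
proof -
  have FC: "F \<subseteq> C" and cF: "convex F"
    using assms(1) face_of_imp_subset face_of_imp_convex by blast+
  have le: "normal_cone C a \<subseteq> normal_cone C b"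
    if a: "a \<in> rel_interior F" and b: "b \<in> rel_interior F" for a b
  proof
    fix u assume u: "u \<in> normal_cone C a"
    have bF: "b \<in> F" using b rel_interior_subset by blast
    obtain e where e: "e > 1" "(1 - e) *\<^sub>R b + e *\<^sub>R a \<in> F"
      using convex_rel_interior_iff[OF cF, of a] a bF by blast
    have "u \<bullet> ((1 - e) *\<^sub>R b + e *\<^sub>R a - a) \<le> 0"
      using u e(2) FC by (auto simp: normal_cone_def)
    then have "(e - 1) * (u \<bullet> a - u \<bullet> b) \<le> 0"
      by (simp add: inner_simps algebra_simps)
    then have "u \<bullet> a \<le> u \<bullet> b"
      using e(1) by (simp add: mult_le_0_iff)
    then show "u \<in> normal_cone C b"
      using u by (force simp: normal_cone_def inner_diff_right)
  qed
  have "F \<noteq> {}" using x rel_interior_subset by blast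
  moreover have "(SOME x. x \<in> rel_interior F) \<in> rel_interior F"
    using x by (rule someI)
  ultimately show ?thesis
    unfolding face_normal_cone_def using x by (simp add: equalityI le)
qed

definition conjugate_face :: "'a::euclidean_space set \<Rightarrow> 'a set \<Rightarrow> 'a set" where
  "conjugate_face K F = {v \<in> polar K. \<forall>u\<in>F. v \<bullet> u = 1}"

definition exposed_closure :: "'a::euclidean_space set \<Rightarrow> 'a set \<Rightarrow> 'a set" where
  "exposed_closure K F = \<Inter>{E \<in> exposed_faces K. F \<subseteq> E}"

text \<open>Coatoms of a subset of an ordered type, taken as a poset in the induced order; there are
  none if this poset has no greatest element.\<close>

definition coatoms :: "'a::order set \<Rightarrow> 'a set" where
  "coatoms L =
     {x \<in> L. \<exists>t\<in>L. (\<forall>y\<in>L. y \<le> t) \<and> x \<noteq> t \<and> (\<forall>y\<in>L. x \<le> y \<and> y \<noteq> t \<longrightarrow> y = x)}"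

definition complete_normal_cone :: "'a::euclidean_space set \<Rightarrow> 'a set \<Rightarrow> bool" where
  "complete_normal_cone C N \<longleftrightarrow>
     coatoms {T \<in> touching_cones C. T \<subseteq> N} \<subseteq> normal_cones C"

text \<open>The codomains of the conjugate face map and of the exposed closure.\<close>

lemma convex_polar: "convex (polar K)"
proof -
  have "polar K = (\<Inter>v\<in>K. {u. v \<bullet> u \<le> 1})"
    by (auto simp: polar_def inner_commute)
  then show ?thesis by (simp add: convex_INT convex_halfspace_le)
qed

lemma polar_polar:
  fixes K :: "'a::euclidean_space set"
  assumes "convex K" "closed K" "0 \<in> K"
  shows "polar (polar K) = K"
proof
  show "K \<subseteq> polar (polar K)" by (auto simp: polar_def inner_commute)
  show "polar (polar K) \<subseteq> K"
  proof
    fix z assume z: "z \<in> polar (polar K)"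
    show "z \<in> K"
    proof (rule ccontr)
      assume "z \<notin> K"
      then obtain a b where ab: "a \<bullet> z < b" "\<forall>x\<in>K. b < a \<bullet> x"
        using separating_hyperplane_closed_point[OF assms(1,2)] by blast
      have b: "b < 0" using ab(2) assms(3) by force
      have "(1 / b) *\<^sub>R a \<in> polar K"
        using ab(2) b by (force simp: polar_def divide_simps)
      then have "z \<bullet> ((1 / b) *\<^sub>R a) \<le> 1"
        using z unfolding polar_def[of "polar K"] by blast
      then show False using ab(1) b by (simp add: divide_simps inner_commute split: if_splits)
    qed
  qed
qed

lemma conjugate_face_in_exposed_faces:
  fixes K :: "'a::euclidean_space set"
  assumes "F \<in> faces K"
  shows "conjugate_face K F \<in> exposed_faces (polar K)"
proof (cases "F = {}")
  case True
  then show ?thesis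
    by (simp add: conjugate_face_def exposed_faces_def convex_polar)
next
  case False
  have "F \<subseteq> K" using assms by (simp add: faces_def face_of_imp_subset)
  then have "polar K \<inter> {v. u \<bullet> v = 1} exposed_face_of polar K" if "u \<in> F" for u
    using that by (intro exposed_face_of_Int_supporting_hyperplane_le convex_polar)
      (auto simp: polar_def inner_commute)
  then have "\<Inter>((\<lambda>u. polar K \<inter> {v. u \<bullet> v = 1}) ` F) exposed_face_of polar K"
    using False by (intro exposed_face_of_Inter) auto
  moreover have "\<Inter>((\<lambda>u. polar K \<inter> {v. u \<bullet> v = 1}) ` F) = conjugate_face K F"
    using False by (auto simp: conjugate_face_def inner_commute)
  ultimately show ?thesis by (simp add: exposed_faces_def)
qed

lemma exposed_closure_in_exposed_faces:
  fixes K :: "'a::euclidean_space set"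
  assumes "convex K" "F \<in> faces K"
  shows "exposed_closure K F \<in> exposed_faces K"
proof -
  have "K \<in> {E \<in> exposed_faces K. F \<subseteq> E}"
    using assms by (simp add: exposed_faces_def faces_def face_of_imp_subset)
  then have "\<Inter>{E \<in> exposed_faces K. F \<subseteq> E} exposed_face_of K"
    by (intro exposed_face_of_Inter) (blast, simp add: exposed_faces_def)
  then show ?thesis by (simp add: exposed_closure_def exposed_faces_def)
qed

end

theory Submission
  imports Defs
begin

text \<open>
  Write \<open>P\<close> for the polar of \<open>K\<close>, \<open>C\<^sub>K\<close> and \<open>C\<^sub>P\<close> for the two conjugate face maps, and \<open>pos G\<close> for
  the convex cone generated by \<open>G\<close> (with \<open>pos {} = {0}\<close>).

  The maps \<open>C\<^sub>K\<close> and \<open>C\<^sub>P\<close> form an antitone Galois connection whose closed elements are the exposed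
  faces (\<open>conjugate_conjugate_exposed\<close>). Hence \<open>C\<^sub>P \<circ> C\<^sub>K\<close> is the exposed closure
  (\<open>exposed_closure_eq\<close>), and a face of \<open>K\<close> is mapped to \<open>F\<close> precisely when its exposed
  closure is \<open>C\<^sub>P F\<close> (\<open>conjugate_face_eq_iff\<close>). This is the statement about preimages.

  Completeness of normal cones is moved from \<open>P\<close> to the face lattice of \<open>K\<close>. The normal cone of
  \<open>P\<close> at a face \<open>F\<close> is \<open>pos (C\<^sub>P F)\<close>, since a non-zero normal vector can be scaled to a functional
  whose maximum on \<open>P\<close> is \<open>1\<close>, that is, to a point of \<open>K\<close>. As a proper face \<open>E\<close> of \<open>K\<close> is a slice of
  \<open>pos E\<close> by a hyperplane off the origin, the non-empty faces of \<open>pos E\<close> are the cones over the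
  faces of \<open>E\<close>. So \<open>pos\<close> is an order isomorphism from the faces of \<open>K\<close> onto the touching
  cones of \<open>P\<close> that takes the exposed faces onto the normal cones (\<open>touching_cones_eq\<close>,
  \<open>normal_cones_eq\<close>, \<open>convex_cone_hull_subset_iff\<close>). Therefore the normal cone at \<open>F\<close> is
  incomplete iff some coatom of the lattice of faces below \<open>E = C\<^sub>P F\<close> is non-exposed
  (\<open>complete_normal_cone_iff\<close>).

  What remains concerns faces of \<open>K\<close> only. If \<open>G\<close> is non-exposed with exposed closure \<open>E\<close>, choose a
  coatom \<open>H\<close> of the faces below \<open>E\<close> with \<open>G \<subseteq> H\<close>. It is non-exposed, because otherwise \<open>E\<close> would not
  be the least exposed face above \<open>G\<close> (\<open>nonexposed_coatom_above\<close>). Conversely, the exposed closure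
  of any non-exposed coatom \<open>H\<close> below an exposed face \<open>E\<close> is \<open>E\<close>
  (\<open>exposed_closure_nonexposed_coatom\<close>). Both surjectivity statements follow, as \<open>C\<^sub>K\<close> depends
  only on the exposed closure.
\<close>

section \<open>Conjugate faces of a convex body and of its polar\<close>

lemma conjugate_face_antimono: "F \<subseteq> G \<Longrightarrow> conjugate_face K G \<subseteq> conjugate_face K F"
  by (auto simp: conjugate_face_def)

lemma conjugate_face_singleton: "conjugate_face K {x} = polar K \<inter> {w. x \<bullet> w = 1}"
  by (auto simp: conjugate_face_def inner_commute)

lemma exposed_face_imp_face: "F \<in> exposed_faces K \<Longrightarrow> F \<in> faces K"
  by (simp add: exposed_faces_def faces_def exposed_face_of_def)

text \<open>The class of bodies singled out here is closed under polarity (\<open>polar_origin_body\<close>), so that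
  each result below applies to the polar as well, and \<open>bipolar\<close> leads back to the body.\<close>

locale origin_body =
  fixes K :: "'a::euclidean_space set"
  assumes convex: "convex K" and compact: "compact K" and zero_interior: "0 \<in> interior K"
begin

lemma zero_mem: "0 \<in> K"
  using zero_interior interior_subset by blast

lemma bipolar: "polar (polar K) = K"
  using convex compact zero_mem by (simp add: polar_polar compact_imp_closed)

lemma zero_mem_polar: "0 \<in> polar K"
  by (simp add: polar_def)

lemma small_multiple_mem:
  obtains e where "e > 0" "e *\<^sub>R u \<in> K"
proof -
  obtain d where d: "d > 0" "cball 0 d \<subseteq> K"
    using zero_interior mem_interior_cball by blast
  have "norm u / (norm u + 1) \<le> 1"
    using norm_ge_zero[of u] by (subst pos_divide_le_eq) (linarith, simp)
  then have "(d / (norm u + 1)) *\<^sub>R u \<in> cball 0 d"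
    using mult_left_mono[of "norm u / (norm u + 1)" 1 d] d(1) by simp
  moreover have "d / (norm u + 1) > 0"
    using d(1) by (intro divide_pos_pos add_nonneg_pos) auto
  ultimately show ?thesis
    using that d(2) by blast
qed

text \<open>A ball of radius \<open>d\<close> inside the body bounds its polar by \<open>1 / d\<close>; a bound \<open>r\<close> on the body puts the
  ball of radius \<open>1 / r\<close> into the polar.\<close>

lemma polar_origin_body: "origin_body (polar K)"
proof
  show "convex (polar K)" by (rule convex_polar)
  have eq: "polar K = (\<Inter>v\<in>K. {u. v \<bullet> u \<le> 1})"
    by (auto simp: polar_def inner_commute)
  have "closed (polar K)"
    unfolding eq by (intro closed_INT ballI closed_halfspace_le)
  obtain d where d: "d > 0" "cball 0 d \<subseteq> K"
    using zero_interior mem_interior_cball by blast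
  have "norm u \<le> 1 / d" if u: "u \<in> polar K" for u
  proof (cases "u = 0")
    case False
    have "(d / norm u) *\<^sub>R u \<in> K"
      using d False by (intro subsetD[OF d(2)]) simp
    then have "u \<bullet> ((d / norm u) *\<^sub>R u) \<le> 1"
      using u by (auto simp: polar_def)
    moreover have "u \<bullet> ((d / norm u) *\<^sub>R u) = d * norm u"
      using False by (simp add: dot_square_norm power2_eq_square)
    ultimately show ?thesis
      using d(1) by (simp add: field_simps)
  qed (use d in simp)
  then have "bounded (polar K)"
    unfolding bounded_iff by blast
  with \<open>closed (polar K)\<close> show "compact (polar K)"
    by (simp add: compact_eq_bounded_closed)
  obtain r where r: "r > 0" "\<And>v. v \<in> K \<Longrightarrow> norm v \<le> r"
    using compact_imp_bounded[OF compact] bounded_pos by metis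
  have "ball 0 (1 / r) \<subseteq> polar K"
  proof
    fix u assume "u \<in> ball (0::'a) (1 / r)"
    then have u: "norm u \<le> 1 / r" by simp
    have "u \<bullet> v \<le> 1" if "v \<in> K" for v
    proof -
      have "u \<bullet> v \<le> norm u * norm v" by (rule norm_cauchy_schwarz)
      also have "\<dots> \<le> (1 / r) * r"
        using u r that by (intro mult_mono) auto
      finally show ?thesis using r(1) by simp
    qed
    then show "u \<in> polar K" by (simp add: polar_def)
  qed
  then show "0 \<in> interior (polar K)"
    using r(1) mem_interior by fastforce
qed

lemma conjugate_conjugate_supset: "F \<subseteq> K \<Longrightarrow> F \<subseteq> conjugate_face (polar K) (conjugate_face K F)"
  using bipolar by (auto simp: conjugate_face_def inner_commute)

text \<open>A functional of the polar that attains its bound \<open>1\<close> at a relative interior point of a face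
  cuts out a face of the body meeting that relative interior, hence attains it on the whole face.\<close>

lemma conjugate_face_rel_interior:
  assumes F: "F face_of K" and x: "x \<in> rel_interior F"
  shows "conjugate_face K {x} = conjugate_face K F"
proof
  have xF: "x \<in> F" using x rel_interior_subset by blast
  then show "conjugate_face K F \<subseteq> conjugate_face K {x}"
    by (intro conjugate_face_antimono) simp
  show "conjugate_face K {x} \<subseteq> conjugate_face K F"
  proof
    fix w assume "w \<in> conjugate_face K {x}"
    then have w: "w \<in> polar K" "w \<bullet> x = 1" by (auto simp: conjugate_face_def)
    have "K \<inter> {y. w \<bullet> y = 1} face_of K"
      using w by (intro face_of_Int_supporting_hyperplane_le convex) (auto simp: polar_def)
    then have "F \<subseteq> K \<inter> {y. w \<bullet> y = 1}"
      using subset_of_face_of[OF _ face_of_imp_subset[OF F]] x xF w(2) face_of_imp_subset[OF F]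
      by blast
    then show "w \<in> conjugate_face K F" using w by (auto simp: conjugate_face_def)
  qed
qed

text \<open>Separating a relative interior point of the face from the interior of the body gives a
  supporting functional, which can be scaled to the value \<open>1\<close> because the origin is interior.
  Thus every proper face lies in an affine hyperplane off the origin and in a proper exposed
  face.\<close>

lemma conjugate_face_nonempty:
  assumes "F face_of K" "F \<noteq> K"
  shows "conjugate_face K F \<noteq> {}"
proof (cases "F = {}")
  case True
  then show ?thesis using zero_mem_polar by (auto simp: conjugate_face_def)
next
  case False
  obtain x where x: "x \<in> rel_interior F"
    using False assms(1) face_of_imp_convex rel_interior_eq_empty by blast
  have xF: "x \<in> F" using x rel_interior_subset by blast
  have xK: "x \<in> K" using xF assms(1) face_of_imp_subset by blast
  have "x \<notin> rel_interior K"
    using face_of_disjoint_rel_interior[OF assms] xF by blast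
  then obtain a where a: "\<And>y. y \<in> K \<Longrightarrow> a \<bullet> x \<le> a \<bullet> y"
      "\<And>y. y \<in> rel_interior K \<Longrightarrow> a \<bullet> x < a \<bullet> y"
    using supporting_hyperplane_relative_frontier[OF convex, of x] xK
      closure_closed[OF compact_imp_closed[OF compact]] by metis
  have neg: "a \<bullet> x < 0"
    using a(2)[of 0] zero_interior interior_subset_rel_interior by fastforce
  define w where "w = (1 / (a \<bullet> x)) *\<^sub>R a"
  have w: "w \<in> polar K"
    using a(1) neg by (auto simp: polar_def w_def divide_simps)
  have wx: "w \<bullet> x = 1" using neg by (simp add: w_def)
  then have "w \<in> conjugate_face K {x}" using w by (simp add: conjugate_face_def)
  then show ?thesis using conjugate_face_rel_interior[OF assms(1) x] by blast
qed

text \<open>A hyperplane that exposes a proper non-empty face misses the origin, so its normal vector can be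
  scaled to a point of the conjugate face; this single point already cuts the double conjugate
  down to the face. The improper faces are conjugate to those of the polar.\<close>

lemma conjugate_conjugate_exposed:
  assumes "F \<in> exposed_faces K"
  shows "conjugate_face (polar K) (conjugate_face K F) = F"
proof -
  consider "F = {}" | "F = K"
    | a b where "F \<noteq> {}" "F \<noteq> K" "K \<subseteq> {x. a \<bullet> x \<le> b}" "F = K \<inter> {x. a \<bullet> x = b}"
    using assms unfolding exposed_faces_def exposed_face_of by blast
  then show ?thesis
  proof cases
    case 1
    then show ?thesis using zero_mem_polar by (force simp: conjugate_face_def)
  next
    case 2
    have "conjugate_face K K = {}" using zero_mem by (force simp: conjugate_face_def)
    moreover have "conjugate_face (polar K) {} = K" using bipolar by (simp add: conjugate_face_def)
    ultimately show ?thesis using 2 by simp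
  next
    case 3
    have "b \<noteq> 0"
    proof
      assume "b = 0"
      then have "0 \<in> F" using 3 zero_mem by simp
      moreover have "F face_of K" using assms by (simp add: exposed_faces_def exposed_face_of_def)
      ultimately show False
        using face_of_disjoint_interior[of F K] 3(2) zero_interior by blast
    qed
    moreover have "b \<ge> 0" using 3(3) zero_mem by force
    ultimately have b: "b > 0" by simp
    define w where "w = (1 / b) *\<^sub>R a"
    have "w \<in> conjugate_face K F"
      using 3(3,4) b by (auto simp: conjugate_face_def polar_def w_def divide_simps)
    then have "conjugate_face (polar K) (conjugate_face K F) \<subseteq> K \<inter> {x. x \<bullet> w = 1}"
      using bipolar by (auto simp: conjugate_face_def)
    also have "\<dots> \<subseteq> F"
      using b 3(4) by (auto simp: w_def field_simps inner_commute)
    finally show ?thesis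
      using conjugate_conjugate_supset[of F] 3(4) by blast
  qed
qed

lemma conjugate_conjugate_conjugate:
  assumes "F \<in> faces K"
  shows "conjugate_face K (conjugate_face (polar K) (conjugate_face K F)) = conjugate_face K F"
  using origin_body.conjugate_conjugate_exposed[OF polar_origin_body
      conjugate_face_in_exposed_faces[OF assms]] bipolar by simp

text \<open>The double conjugate is an exposed face above \<open>F\<close>, and by monotonicity it lies below every
  exposed face above \<open>F\<close>, since those are fixed by double conjugation.\<close>

lemma exposed_closure_eq:
  assumes "F \<in> faces K"
  shows "exposed_closure K F = conjugate_face (polar K) (conjugate_face K F)"
proof
  have "conjugate_face (polar K) (conjugate_face K F) \<in> exposed_faces (polar (polar K))"
    by (intro conjugate_face_in_exposed_faces exposed_face_imp_face assms)
  moreover have "F \<subseteq> K" using assms by (simp add: faces_def face_of_imp_subset)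
  ultimately show "exposed_closure K F \<subseteq> conjugate_face (polar K) (conjugate_face K F)"
    unfolding exposed_closure_def using conjugate_conjugate_supset bipolar by auto
  have "conjugate_face (polar K) (conjugate_face K F) \<subseteq> E"
    if "E \<in> exposed_faces K" "F \<subseteq> E" for E
    using conjugate_face_antimono[OF conjugate_face_antimono[OF that(2)]]
      conjugate_conjugate_exposed[OF that(1)] by blast
  then show "conjugate_face (polar K) (conjugate_face K F) \<subseteq> exposed_closure K F"
    unfolding exposed_closure_def by blast
qed

lemma conjugate_face_exposed_closure:
  assumes "F \<in> faces K"
  shows "conjugate_face K (exposed_closure K F) = conjugate_face K F"
  using assms by (simp add: exposed_closure_eq conjugate_conjugate_conjugate)

lemma conjugate_face_eq_iff:
  assumes "G \<in> faces K" "F \<in> exposed_faces (polar K)"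
  shows "conjugate_face K G = F \<longleftrightarrow> exposed_closure K G = conjugate_face (polar K) F"
proof
  assume "exposed_closure K G = conjugate_face (polar K) F"
  then have "conjugate_face K G = conjugate_face K (conjugate_face (polar K) F)"
    using conjugate_face_exposed_closure[OF assms(1)] by simp
  then show "conjugate_face K G = F"
    using origin_body.conjugate_conjugate_exposed[OF polar_origin_body assms(2)] bipolar by simp
qed (use exposed_closure_eq[OF assms(1)] in simp)

end

section \<open>Cones over convex sets\<close>

text \<open>A convex cone hull always contains the origin, so \<open>convex_cone hull {} = {0}\<close>. This makes the
  empty face correspond to the zero cone, without an exception in the isomorphism below.\<close>

lemma mem_convex_cone_hull:
  assumes "convex G"
  shows "x \<in> convex_cone hull G \<longleftrightarrow> x = 0 \<or> (\<exists>c>0. \<exists>g\<in>G. x = c *\<^sub>R g)"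
proof -
  have "convex hull G = G" using assms by (simp add: convex_hull_eq)
  then have "x \<in> convex_cone hull G \<longleftrightarrow> x = 0 \<or> (\<exists>c\<ge>0. \<exists>g\<in>G. x = c *\<^sub>R g)"
    by (auto simp: convex_cone_hull_separate conic_hull_explicit)
  also have "\<dots> \<longleftrightarrow> x = 0 \<or> (\<exists>c>0. \<exists>g\<in>G. x = c *\<^sub>R g)"
    by (metis order_le_less scaleR_zero_left)
  finally show ?thesis .
qed

lemma conic_nonempty_eq_convex_cone_hull_slice:
  assumes T: "conic T" "T \<noteq> {}" "T \<subseteq> convex_cone hull E" and E: "convex E" "convex (T \<inter> E)"
  shows "T = convex_cone hull (T \<inter> E)"
proof
  show "T \<subseteq> convex_cone hull (T \<inter> E)"
  proof
    fix x assume x: "x \<in> T"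
    show "x \<in> convex_cone hull (T \<inter> E)"
    proof (cases "x = 0")
      case False
      then obtain c g where cg: "c > 0" "g \<in> E" "x = c *\<^sub>R g"
        using x T(3) mem_convex_cone_hull[OF E(1)] by blast
      then have "g = (1 / c) *\<^sub>R x" by simp
      then have "g \<in> T" using conicD[OF T(1) x] cg(1) by simp
      then show ?thesis using cg mem_convex_cone_hull[OF E(2)] by blast
    qed (simp add: mem_convex_cone_hull[OF E(2)])
  qed
  show "convex_cone hull (T \<inter> E) \<subseteq> T"
  proof
    fix x assume "x \<in> convex_cone hull (T \<inter> E)"
    then show "x \<in> T"
      using mem_convex_cone_hull[OF E(2)] conicD[OF T(1)] conic_contains_0[OF T(1)] T(2)
      by (auto intro: less_imp_le)
  qed
qed

text \<open>The functional \<open>w\<close> measures the radial coordinate on the cone over \<open>E\<close>. If a sum of two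
  non-zero elements of that cone lies over \<open>G\<close>, then normalising by \<open>w\<close> turns it into a convex
  combination in \<open>E\<close>, to which the face property of \<open>G\<close> applies.\<close>

lemma convex_cone_hull_face:
  assumes E: "convex E" and w: "\<And>x. x \<in> E \<Longrightarrow> w \<bullet> x = 1" and G: "G face_of E"
  shows "convex_cone hull G face_of convex_cone hull E"
proof -
  have cG: "convex G" and GE: "G \<subseteq> E"
    using G face_of_imp_convex face_of_imp_subset by blast+
  have key: "a \<in> convex_cone hull G"
    if a: "a \<in> convex_cone hull E" and b: "b \<in> convex_cone hull E"
      and x: "a + b \<in> convex_cone hull G" for a b
  proof (cases "a = 0 \<or> b = 0")
    case True
    then show ?thesis using x by (auto simp: mem_convex_cone_hull[OF cG])
  next
    case False
    then obtain s e t f where st: "s > 0" "e \<in> E" "a = s *\<^sub>R e" "t > 0" "f \<in> E" "b = t *\<^sub>R f"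
      using a b mem_convex_cone_hull[OF E] by meson
    have wab: "w \<bullet> (a + b) = s + t"
      using st w by (simp add: inner_add_right)
    then have "a + b \<noteq> 0" using st(1,4) by auto
    then obtain r g where rg: "r > 0" "g \<in> G" "a + b = r *\<^sub>R g"
      using x mem_convex_cone_hull[OF cG] by blast
    have r: "r = s + t" using wab rg w GE by auto
    have g: "g = (1 - t / r) *\<^sub>R e + (t / r) *\<^sub>R f"
    proof -
      have "g = (1 / r) *\<^sub>R (a + b)" using rg by simp
      also have "\<dots> = (s / r) *\<^sub>R e + (t / r) *\<^sub>R f"
        using st by (simp add: scaleR_add_right)
      also have "s / r = 1 - t / r" using rg(1) r by (simp add: field_simps)
      finally show ?thesis .
    qed
    have "e \<in> G"
    proof (cases "e = f")
      case True
      then have "g = e" using g by (simp add: algebra_simps)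
      then show ?thesis using rg by simp
    next
      case False
      have "g \<in> open_segment e f"
        unfolding in_segment using g False rg(1) r st(1,4)
        by (intro conjI exI[of _ "t / r"]) auto
      then show ?thesis using G st rg(2) unfolding face_of_def by blast
    qed
    then show ?thesis using st mem_convex_cone_hull[OF cG] by blast
  qed
  have scale: "c *\<^sub>R x \<in> convex_cone hull S" if "x \<in> convex_cone hull S" "c \<ge> 0"
    for c x and S :: "'a set"
    using that conicD conic_convex_cone_hull by blast
  show ?thesis
    unfolding face_of_def
  proof (intro conjI ballI impI)
    show "convex_cone hull G \<subseteq> convex_cone hull E" using GE by (rule hull_mono)
    show "convex (convex_cone hull G)" by (rule convex_convex_cone_hull)
    fix a b x
    assume a: "a \<in> convex_cone hull E" and b: "b \<in> convex_cone hull E"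
      and x: "x \<in> convex_cone hull G" and ab: "x \<in> open_segment a b"
    obtain u where u: "0 < u" "u < 1" "x = (1 - u) *\<^sub>R a + u *\<^sub>R b"
      using ab by (auto simp: in_segment)
    have A: "(1 - u) *\<^sub>R a \<in> convex_cone hull E" and B: "u *\<^sub>R b \<in> convex_cone hull E"
      using a b u scale by auto
    have "(1 - u) *\<^sub>R a \<in> convex_cone hull G" "u *\<^sub>R b \<in> convex_cone hull G"
      using key[OF A B] key[OF B A] x u by (auto simp: add.commute)
    then show "a \<in> convex_cone hull G" "b \<in> convex_cone hull G"
      using scale[of "(1 - u) *\<^sub>R a" G "1 / (1 - u)"] scale[of "u *\<^sub>R b" G "1 / u"] u by auto
  qed
qed

text \<open>Faces of a cone are cones, so a non-empty face of the cone over \<open>E\<close> is recovered from its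
  intersection with the base \<open>E\<close>.\<close>

lemma face_of_convex_cone_hull_iff:
  assumes E: "convex E" and w: "\<And>x. x \<in> E \<Longrightarrow> w \<bullet> x = 1"
  shows "T face_of convex_cone hull E \<and> T \<noteq> {} \<longleftrightarrow> (\<exists>G. G face_of E \<and> T = convex_cone hull G)"
proof
  assume T: "T face_of convex_cone hull E \<and> T \<noteq> {}"
  have "(T \<inter> E) face_of (convex_cone hull E \<inter> E)"
    using T E by (intro face_of_slice) auto
  moreover have "convex_cone hull E \<inter> E = E"
    using hull_subset by fastforce
  ultimately have G: "(T \<inter> E) face_of E" by simp
  have "conic T" using T face_of_conic conic_convex_cone_hull by blast
  then have "T = convex_cone hull (T \<inter> E)"
    using T E G face_of_imp_subset face_of_imp_convex
    by (intro conic_nonempty_eq_convex_cone_hull_slice) blast+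
  then show "\<exists>G. G face_of E \<and> T = convex_cone hull G" using G by blast
next
  assume "\<exists>G. G face_of E \<and> T = convex_cone hull G"
  then obtain G where G: "G face_of E" "T = convex_cone hull G" by blast
  have "T \<noteq> {}"
    using G mem_convex_cone_hull[of G 0] face_of_imp_convex by blast
  then show "T face_of convex_cone hull E \<and> T \<noteq> {}"
    using convex_cone_hull_face[OF E w G(1)] G(2) by simp
qed

section \<open>Normal cones and touching cones\<close>

context origin_body
begin

lemma convex_cone_hull_body: "convex_cone hull K = UNIV"
proof -
  have "u \<in> convex_cone hull K" for u
  proof -
    obtain e where e: "e > 0" "e *\<^sub>R u \<in> K" by (rule small_multiple_mem)
    then have "u = (1 / e) *\<^sub>R (e *\<^sub>R u)" "1 / e > 0" by simp_all
    then show ?thesis using e mem_convex_cone_hull[OF convex] by blast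
  qed
  then show ?thesis by blast
qed

text \<open>A point \<open>g\<close> of a proper face \<open>G\<close> that equals \<open>c h\<close> with \<open>h\<close> in a proper face \<open>H\<close> has \<open>c = 1\<close>:
  a functional that is at most \<open>1\<close> on the body and equal to \<open>1\<close> on \<open>H\<close> gives \<open>c \<le> 1\<close>, and one that
  is equal to \<open>1\<close> on \<open>G\<close> gives \<open>c \<ge> 1\<close>.\<close>

lemma convex_cone_hull_subset_iff:
  assumes G: "G \<in> faces K" and H: "H \<in> faces K"
  shows "convex_cone hull G \<subseteq> convex_cone hull H \<longleftrightarrow> G \<subseteq> H"
proof
  assume sub: "convex_cone hull G \<subseteq> convex_cone hull H"
  have GK: "G \<subseteq> K" and HK: "H \<subseteq> K" and cH: "convex H"
    using assms face_of_imp_subset face_of_imp_convex by (auto simp: faces_def)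
  show "G \<subseteq> H"
  proof (cases "H = K")
    case False
    then obtain w where w: "w \<in> polar K" "\<And>h. h \<in> H \<Longrightarrow> w \<bullet> h = 1"
      using conjugate_face_nonempty[of H] H by (auto simp: faces_def conjugate_face_def)
    have "G \<noteq> K"
    proof
      assume "G = K"
      then have "- w \<in> convex_cone hull H" using sub convex_cone_hull_body by auto
      then consider "w = 0" | c h where "c > 0" "h \<in> H" "- w = c *\<^sub>R h"
        using mem_convex_cone_hull[OF cH] by force
      then have "w = 0"
      proof cases
        case 2
        have "w \<bullet> (- w) = c" using w(2)[OF 2(2)] 2(3) by simp
        then show ?thesis using 2(1) inner_ge_zero[of w] by simp
      qed
      then have "H = {}" using w(2) by force
      then have "convex_cone hull H = {0}" using mem_convex_cone_hull[OF cH] by auto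
      then have "UNIV \<subseteq> {0::'a}" using sub \<open>G = K\<close> convex_cone_hull_body by simp
      then show False using UNIV_not_singleton[of "0::'a"] by blast
    qed
    then obtain v where v: "v \<in> polar K" "\<And>g. g \<in> G \<Longrightarrow> v \<bullet> g = 1"
      using conjugate_face_nonempty[of G] G by (auto simp: faces_def conjugate_face_def)
    show ?thesis
    proof
      fix g assume g: "g \<in> G"
      have "g \<noteq> 0" using v(2)[OF g] by auto
      moreover have "g \<in> convex_cone hull H" using g sub hull_subset by fastforce
      ultimately obtain c h where ch: "c > 0" "h \<in> H" "g = c *\<^sub>R h"
        using mem_convex_cone_hull[OF cH] by blast
      have "c \<le> 1"
        using w(1) w(2)[OF ch(2)] g GK ch(3) by (force simp: polar_def)
      moreover have "v \<bullet> h \<le> 1" using v(1) ch(2) HK by (auto simp: polar_def)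
      moreover have "c * (v \<bullet> h) = 1" using v(2)[OF g] ch(3) by simp
      ultimately have "c = 1"
        using ch(1) by (metis mult_left_mono mult.right_neutral less_imp_le order_antisym)
      then show "g \<in> H" using ch by simp
    qed
  qed (use GK in simp)
qed (rule hull_mono)

text \<open>As the origin is interior, a non-zero normal vector \<open>u\<close> at \<open>x\<close> satisfies \<open>u \<bullet> x > 0\<close>; dividing by
  this value gives a point of the polar whose product with \<open>x\<close> is \<open>1\<close>.\<close>

lemma normal_cone_eq:
  assumes x: "x \<in> K"
  shows "normal_cone K x = convex_cone hull (conjugate_face K {x})"
proof -
  have c: "convex (conjugate_face K {x})"
    unfolding conjugate_face_singleton by (intro convex_Int convex_polar convex_hyperplane)
  show ?thesis
  proof (intro equalityI subsetI)
    fix u assume u: "u \<in> normal_cone K x"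
    show "u \<in> convex_cone hull (conjugate_face K {x})"
    proof (cases "u = 0")
      case False
      obtain e where e: "e > 0" "e *\<^sub>R u \<in> K" by (rule small_multiple_mem)
      have "e * (u \<bullet> u) \<le> u \<bullet> x"
        using u e(2) by (force simp: normal_cone_def inner_diff_right)
      moreover have "e * (u \<bullet> u) > 0" using e(1) False by simp
      ultimately have pos: "u \<bullet> x > 0" by linarith
      define w where "w = (1 / (u \<bullet> x)) *\<^sub>R u"
      have "w \<in> conjugate_face K {x}"
        using u pos by (auto simp: w_def conjugate_face_def polar_def normal_cone_def inner_diff_right)
      moreover have "u = (u \<bullet> x) *\<^sub>R w" using pos by (simp add: w_def)
      ultimately show ?thesis using pos mem_convex_cone_hull[OF c] by blast
    qed (simp add: mem_convex_cone_hull[OF c])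
  next
    fix u assume "u \<in> convex_cone hull (conjugate_face K {x})"
    then show "u \<in> normal_cone K x"
      unfolding mem_convex_cone_hull[OF c]
      by (auto simp: normal_cone_def conjugate_face_def polar_def inner_diff_right)
  qed
qed

lemma face_normal_cone_eq_convex_cone_hull:
  assumes "F \<in> faces K"
  shows "face_normal_cone K F = convex_cone hull (conjugate_face K F)"
proof (cases "F = {}")
  case True
  then show ?thesis
    using origin_body.convex_cone_hull_body[OF polar_origin_body]
    by (simp add: face_normal_cone_def conjugate_face_def)
next
  case False
  have F: "F face_of K" using assms by (simp add: faces_def)
  then obtain x where x: "x \<in> rel_interior F"
    using False face_of_imp_convex rel_interior_eq_empty by blast
  then have "x \<in> K" using rel_interior_subset face_of_imp_subset[OF F] by blast
  then show ?thesis
    using face_normal_cone_eq[OF F x] normal_cone_eq conjugate_face_rel_interior[OF F x] by simp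
qed

text \<open>The normal cone \<open>UNIV\<close>, adjoined by convention, is the cone over the improper face \<open>polar K\<close>.
  An exposed face \<open>G\<close> of the polar is the conjugate of its own conjugate face \<open>F\<close>, so the cone over
  \<open>G\<close> is the normal cone of \<open>F\<close>.\<close>

lemma normal_cones_eq: "normal_cones K = (\<lambda>G. convex_cone hull G) ` exposed_faces (polar K)"
proof
  have "polar K \<in> exposed_faces (polar K)"
    by (simp add: exposed_faces_def convex_polar)
  then have "UNIV \<in> (\<lambda>G. convex_cone hull G) ` exposed_faces (polar K)"
    using origin_body.convex_cone_hull_body[OF polar_origin_body] by force
  moreover have "conjugate_face K {x} \<in> exposed_faces (polar K)" if "x \<in> K" for x
    unfolding conjugate_face_singleton exposed_faces_def mem_Collect_eq
    using that by (intro exposed_face_of_Int_supporting_hyperplane_le convex_polar)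
      (auto simp: polar_def inner_commute)
  ultimately show "normal_cones K \<subseteq> (\<lambda>G. convex_cone hull G) ` exposed_faces (polar K)"
    by (auto simp: normal_cones_def normal_cone_eq)
  show "(\<lambda>G. convex_cone hull G) ` exposed_faces (polar K) \<subseteq> normal_cones K"
  proof clarify
    fix G assume G: "G \<in> exposed_faces (polar K)"
    define F where "F = conjugate_face (polar K) G"
    have F: "F \<in> faces K"
      using conjugate_face_in_exposed_faces[OF exposed_face_imp_face[OF G]] bipolar
      by (simp add: F_def exposed_face_imp_face)
    have "conjugate_face K F = G"
      using origin_body.conjugate_conjugate_exposed[OF polar_origin_body G] bipolar
      by (simp add: F_def)
    then have "convex_cone hull G = face_normal_cone K F"
      using face_normal_cone_eq_convex_cone_hull[OF F] by simp
    also have "\<dots> \<in> normal_cones K"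
    proof (cases "F = {}")
      case False
      have cF: "F face_of K" using F by (simp add: faces_def)
      then obtain x where x: "x \<in> rel_interior F"
        using False face_of_imp_convex rel_interior_eq_empty by blast
      then have "x \<in> K" using rel_interior_subset face_of_imp_subset[OF cF] by blast
      then show ?thesis
        using face_normal_cone_eq[OF cF x] by (simp add: normal_cones_def)
    qed (simp add: face_normal_cone_def normal_cones_def)
    finally show "convex_cone hull G \<in> normal_cones K" .
  qed
qed

text \<open>The improper face is treated separately, since the cone over it is the whole space, whose only
  non-empty face is itself. Every other face of the polar lies in a proper exposed face, and the
  faces of the cone over the latter are known.\<close>

lemma touching_cones_eq: "touching_cones K = (\<lambda>G. convex_cone hull G) ` faces (polar K)"
proof -
  interpret P: origin_body "polar K" by (rule polar_origin_body)
  have slice: "T face_of convex_cone hull E \<and> T \<noteq> {} \<longleftrightarrow> (\<exists>G. G face_of E \<and> T = convex_cone hull G)"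
    if E: "E \<in> faces (polar K)" "E \<noteq> polar K" for E T
  proof -
    have fE: "E face_of polar K" using E(1) by (simp add: faces_def)
    then obtain w where "\<And>x. x \<in> E \<Longrightarrow> w \<bullet> x = 1"
      using P.conjugate_face_nonempty[of E] E(2) by (auto simp: conjugate_face_def)
    then show ?thesis
      using face_of_convex_cone_hull_iff face_of_imp_convex[OF fE] by blast
  qed
  show ?thesis
  proof (intro equalityI subsetI)
    fix T assume "T \<in> touching_cones K"
    then obtain E where T: "T \<noteq> {}" "T face_of convex_cone hull E" and E: "E \<in> exposed_faces (polar K)"
      by (auto simp: touching_cones_def normal_cones_eq)
    have fE: "E face_of polar K" using exposed_face_imp_face[OF E] by (simp add: faces_def)
    show "T \<in> (\<lambda>G. convex_cone hull G) ` faces (polar K)"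
    proof (cases "E = polar K")
      case True
      then have "T = convex_cone hull E"
        using T face_of_affine_trivial[of UNIV T] P.convex_cone_hull_body by auto
      then show ?thesis using fE by (auto simp: faces_def)
    next
      case False
      then obtain G where "G face_of E" "T = convex_cone hull G"
        using slice[of E T] T fE by (auto simp: faces_def)
      then show ?thesis using face_of_trans[OF _ fE] by (auto simp: faces_def)
    qed
  next
    fix T assume "T \<in> (\<lambda>G. convex_cone hull G) ` faces (polar K)"
    then obtain G where G: "G face_of polar K" "T = convex_cone hull G" by (auto simp: faces_def)
    show "T \<in> touching_cones K"
    proof (cases "G = polar K")
      case True
      then have "T = UNIV" using G P.convex_cone_hull_body by simp
      then show ?thesis by (auto simp: touching_cones_def normal_cones_def face_of_refl)
    next
      case False
      have Gf: "G \<in> faces (polar K)" using G by (simp add: faces_def)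
      define E where "E = conjugate_face K (conjugate_face (polar K) G)"
      have E: "E \<in> exposed_faces (polar K)"
        using exposed_closure_in_exposed_faces[OF convex_polar Gf] P.exposed_closure_eq[OF Gf] bipolar
        by (simp add: E_def)
      have GE: "G \<subseteq> E"
        using P.conjugate_conjugate_supset[OF face_of_imp_subset[OF G(1)]] bipolar by (simp add: E_def)
      have "E \<noteq> polar K"
        using P.conjugate_face_nonempty[OF G(1) False] zero_mem_polar
        by (force simp: E_def conjugate_face_def)
      moreover have fE: "E face_of polar K"
        using exposed_face_imp_face[OF E] by (simp add: faces_def)
      moreover have "G face_of E"
        using face_of_subset[OF G(1) GE face_of_imp_subset[OF fE]] .
      ultimately have "T face_of convex_cone hull E \<and> T \<noteq> {}"
        using slice[of E T] G(2) by (auto simp: faces_def)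
      then show ?thesis using E by (auto simp: touching_cones_def normal_cones_eq)
    qed
  qed
qed

end

section \<open>Coatoms and completeness\<close>

lemma coatoms_image:
  fixes f :: "'a::order \<Rightarrow> 'b::order"
  assumes "\<And>x y. x \<in> L \<Longrightarrow> y \<in> L \<Longrightarrow> f x \<le> f y \<longleftrightarrow> x \<le> y"
  shows "coatoms (f ` L) = f ` coatoms L"
proof -
  have "f x = f y \<longleftrightarrow> x = y" if "x \<in> L" "y \<in> L" for x y
    using assms[of x y] assms[of y x] that by (metis order_antisym order_refl)
  then have "f x \<in> coatoms (f ` L) \<longleftrightarrow> x \<in> coatoms L" if "x \<in> L" for x
    using that assms unfolding coatoms_def by (simp cong: bex_cong ball_cong)
  moreover have "coatoms L \<subseteq> L" "coatoms (f ` L) \<subseteq> f ` L"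
    by (auto simp: coatoms_def)
  ultimately show ?thesis by blast
qed

lemma coatoms_with_top:
  assumes "t \<in> L" "\<And>y. y \<in> L \<Longrightarrow> y \<le> t"
  shows "x \<in> coatoms L \<longleftrightarrow> x \<in> L \<and> x \<noteq> t \<and> (\<forall>y\<in>L. x \<le> y \<and> y \<noteq> t \<longrightarrow> y = x)"
proof -
  have "t' = t" if "t' \<in> L" "\<forall>y\<in>L. y \<le> t'" for t'
    using that assms by (blast intro: order_antisym)
  then show ?thesis using assms unfolding coatoms_def by blast
qed

context origin_body
begin

text \<open>The cone over \<open>conjugate_face (polar K) F\<close> is the normal cone in question, and the order
  isomorphism between faces and touching cones preserves coatoms.\<close>

lemma complete_normal_cone_iff:
  assumes F: "F \<in> exposed_faces (polar K)"
  shows "complete_normal_cone (polar K) (face_normal_cone (polar K) F) \<longleftrightarrow>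
    coatoms {G \<in> faces K. G \<subseteq> conjugate_face (polar K) F} \<subseteq> exposed_faces K"
proof -
  interpret P: origin_body "polar K" by (rule polar_origin_body)
  define E where "E = conjugate_face (polar K) F"
  have Ff: "F \<in> faces (polar K)" using F by (rule exposed_face_imp_face)
  have E: "E \<in> faces K"
    using conjugate_face_in_exposed_faces[OF Ff] bipolar by (simp add: E_def exposed_face_imp_face)
  have inj: "inj_on (\<lambda>G. convex_cone hull G) (faces K)"
    using convex_cone_hull_subset_iff by (intro inj_onI equalityI) blast+
  have "{T \<in> touching_cones (polar K). T \<subseteq> convex_cone hull E} =
      (\<lambda>G. convex_cone hull G) ` {G \<in> faces K. G \<subseteq> E}"
    unfolding P.touching_cones_eq bipolar using convex_cone_hull_subset_iff E by blast
  then have "coatoms {T \<in> touching_cones (polar K). T \<subseteq> convex_cone hull E} =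
      (\<lambda>G. convex_cone hull G) ` coatoms {G \<in> faces K. G \<subseteq> E}"
    using coatoms_image[of "{G \<in> faces K. G \<subseteq> E}" "\<lambda>G. convex_cone hull G"]
      convex_cone_hull_subset_iff by auto
  moreover have "coatoms {G \<in> faces K. G \<subseteq> E} \<subseteq> faces K" by (auto simp: coatoms_def)
  ultimately show ?thesis
    using inj_on_image_subset_iff[OF inj, of "coatoms {G \<in> faces K. G \<subseteq> E}" "exposed_faces K"]
      exposed_face_imp_face[of _ K, THEN subsetI]
    unfolding complete_normal_cone_def P.face_normal_cone_eq_convex_cone_hull[OF Ff]
      P.normal_cones_eq bipolar E_def[symmetric] by auto
qed

text \<open>Proper faces of a face have smaller dimension, so a face of maximal dimension among those strictly
  below \<open>E\<close> and above \<open>G\<close> is a coatom.\<close>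

lemma coatom_above:
  assumes E: "E \<in> faces K" and G: "G \<in> faces K" "G \<subseteq> E" "G \<noteq> E"
  obtains H where "H \<in> coatoms {H \<in> faces K. H \<subseteq> E}" "G \<subseteq> H"
proof -
  define A where "A = {H \<in> faces K. G \<subseteq> H \<and> H \<subseteq> E \<and> H \<noteq> E}"
  have "G \<in> A" using G by (simp add: A_def)
  \<comment> \<open>The shift by one keeps the dimension \<open>-1\<close> of the empty face apart from \<open>0\<close> under \<open>nat\<close>.\<close>
  moreover have "nat (aff_dim H + 1) < DIM('a) + 2" for H :: "'a set"
    using aff_dim_le_DIM[of H] by linarith
  ultimately obtain H where H: "H \<in> A"
      and max: "\<And>J. J \<in> A \<Longrightarrow> nat (aff_dim J + 1) \<le> nat (aff_dim H + 1)"
    using ex_has_greatest_nat[of "\<lambda>H. H \<in> A" G "\<lambda>H. nat (aff_dim H + 1)" "DIM('a) + 2"]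
    by blast
  have "J = H" if J: "J \<in> faces K" "J \<subseteq> E" "H \<subseteq> J" "J \<noteq> E" for J
  proof (rule ccontr)
    assume "J \<noteq> H"
    have fH: "H face_of K" and fJ: "J face_of K" using H J by (auto simp: A_def faces_def)
    have "H face_of J" using face_of_subset[OF fH J(3) face_of_imp_subset[OF fJ]] .
    then have "aff_dim H < aff_dim J"
      using face_of_aff_dim_lt[OF face_of_imp_convex[OF fJ]] \<open>J \<noteq> H\<close> by blast
    moreover have "J \<in> A" using J H by (auto simp: A_def)
    ultimately show False
      using max[of J] aff_dim_geq[of H] by linarith
  qed
  moreover have "H \<in> faces K" "H \<subseteq> E" "H \<noteq> E" using H by (auto simp: A_def)
  ultimately have "H \<in> coatoms {H \<in> faces K. H \<subseteq> E}"
    using E by (subst coatoms_with_top[of E]) blast+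
  then show ?thesis using that H by (auto simp: A_def)
qed

text \<open>The exposed closure is the least exposed face above \<open>G\<close>, so no face strictly between the two is
  exposed.\<close>

lemma nonexposed_coatom_above:
  assumes G: "G \<in> faces K" "G \<notin> exposed_faces K"
  obtains H where "H \<in> coatoms {H \<in> faces K. H \<subseteq> exposed_closure K G}"
    "H \<notin> exposed_faces K" "G \<subseteq> H"
proof -
  let ?E = "exposed_closure K G"
  have E: "?E \<in> exposed_faces K" by (rule exposed_closure_in_exposed_faces[OF convex G(1)])
  have GE: "G \<subseteq> ?E" by (auto simp: exposed_closure_def)
  obtain H where H: "H \<in> coatoms {H \<in> faces K. H \<subseteq> ?E}" "G \<subseteq> H"
    using coatom_above[OF exposed_face_imp_face[OF E] G(1) GE] E G(2) by metis
  have top: "?E \<in> {H \<in> faces K. H \<subseteq> ?E}" using exposed_face_imp_face[OF E] by simp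
  have "H \<subseteq> ?E \<and> H \<noteq> ?E"
    using H(1) by (subst (asm) coatoms_with_top[OF top]) blast+
  moreover have "?E \<subseteq> H" if "H \<in> exposed_faces K"
    using that H(2) by (auto simp: exposed_closure_def)
  ultimately show ?thesis using that H by blast
qed

text \<open>The exposed closure of \<open>H\<close> lies between \<open>H\<close> and \<open>E\<close> and differs from \<open>H\<close>, hence it is \<open>E\<close>.\<close>

lemma exposed_closure_nonexposed_coatom:
  assumes E: "E \<in> exposed_faces K" and H: "H \<in> coatoms {H \<in> faces K. H \<subseteq> E}" "H \<notin> exposed_faces K"
  shows "exposed_closure K H = E"
proof -
  have top: "E \<in> {H \<in> faces K. H \<subseteq> E}" using exposed_face_imp_face[OF E] by simp
  have Hf: "H \<in> faces K" "H \<subseteq> E" using H(1) by (auto simp: coatoms_def)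
  have ex: "exposed_closure K H \<in> exposed_faces K"
    by (rule exposed_closure_in_exposed_faces[OF convex Hf(1)])
  have "exposed_closure K H \<subseteq> E" "H \<subseteq> exposed_closure K H"
    using E Hf(2) by (auto simp: exposed_closure_def)
  moreover have "exposed_closure K H \<in> faces K" by (rule exposed_face_imp_face[OF ex])
  moreover have "exposed_closure K H \<noteq> H" using ex H(2) by metis
  moreover have "J = H" if "J \<in> faces K" "J \<subseteq> E" "H \<subseteq> J" "J \<noteq> E" for J
    using H(1) that by (subst (asm) coatoms_with_top[OF top]) blast+
  ultimately show ?thesis by metis
qed

end

section \<open>Non-exposed faces and incomplete normal cones\<close>

theorem theorem4p6:
  fixes K :: "'a::euclidean_space set"
  assumes "convex K" and "compact K" and "0 \<in> interior K"
  shows "conjugate_face K ` (faces K - exposed_faces K) =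
           {F \<in> exposed_faces (polar K).
              \<not> complete_normal_cone (polar K) (face_normal_cone (polar K) F)}
       \<and> conjugate_face K `
           {G \<in> faces K - exposed_faces K.
              \<exists>F\<in>exposed_faces K. G \<in> coatoms {H \<in> faces K. H \<subseteq> F}} =
           conjugate_face K ` (faces K - exposed_faces K)
       \<and> (\<forall>F\<in>exposed_faces (polar K).
            {G \<in> faces K. conjugate_face K G = F} =
            {G \<in> faces K. exposed_closure K G = conjugate_face (polar K) F})"
proof -
  interpret origin_body K using assms by unfold_locales
  let ?C = "conjugate_face K" and ?N = "faces K - exposed_faces K"
  let ?coat = "\<lambda>E. coatoms {H \<in> faces K. H \<subseteq> E}"
  have coat_faces: "?coat E \<subseteq> faces K" for E by (auto simp: coatoms_def)
  \<comment> \<open>A non-exposed face may be replaced by a non-exposed coatom with the same conjugate face.\<close>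
  have lift: "\<exists>H \<in> ?coat (exposed_closure K G) - exposed_faces K. ?C H = ?C G" if "G \<in> ?N" for G
  proof -
    have G: "G \<in> faces K" "G \<notin> exposed_faces K" using that by auto
    obtain H where H: "H \<in> ?coat (exposed_closure K G)" "H \<notin> exposed_faces K"
      by (rule nonexposed_coatom_above[OF G])
    have "exposed_closure K H = exposed_closure K G"
      using exposed_closure_nonexposed_coatom[OF _ H] exposed_closure_in_exposed_faces[OF convex G(1)]
      by blast
    then have "?C H = ?C G"
      using H coat_faces G(1) conjugate_face_exposed_closure by (metis subsetD)
    then show ?thesis using H by blast
  qed
  have "?C G \<in> exposed_faces (polar K) \<and>
      \<not> complete_normal_cone (polar K) (face_normal_cone (polar K) (?C G))" if "G \<in> ?N" for G
  proof
    have G: "G \<in> faces K" using that by simp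
    show F: "?C G \<in> exposed_faces (polar K)" by (rule conjugate_face_in_exposed_faces[OF G])
    show "\<not> complete_normal_cone (polar K) (face_normal_cone (polar K) (?C G))"
      using lift[OF that] unfolding complete_normal_cone_iff[OF F] exposed_closure_eq[OF G] by blast
  qed
  moreover have "F \<in> ?C ` ?N"
    if F: "F \<in> exposed_faces (polar K)"
      and inc: "\<not> complete_normal_cone (polar K) (face_normal_cone (polar K) F)" for F
  proof -
    obtain H where H: "H \<in> ?coat (conjugate_face (polar K) F)" "H \<notin> exposed_faces K"
      using inc complete_normal_cone_iff[OF F] by blast
    have "conjugate_face (polar K) F \<in> exposed_faces K"
      using conjugate_face_in_exposed_faces[OF exposed_face_imp_face[OF F]] bipolar by simp
    then have "exposed_closure K H = conjugate_face (polar K) F"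
      using exposed_closure_nonexposed_coatom H by blast
    then have "?C H = F" using conjugate_face_eq_iff[OF _ F] H coat_faces by blast
    then show ?thesis using H coat_faces by blast
  qed
  moreover have "?C G \<in> ?C ` {G \<in> ?N. \<exists>E\<in>exposed_faces K. G \<in> ?coat E}" if G: "G \<in> ?N" for G
  proof -
    obtain H where H: "H \<in> ?coat (exposed_closure K G) - exposed_faces K" "?C H = ?C G"
      using lift[OF G] by blast
    moreover have "exposed_closure K G \<in> exposed_faces K"
      using G exposed_closure_in_exposed_faces[OF convex] by blast
    ultimately have "H \<in> {G \<in> ?N. \<exists>E\<in>exposed_faces K. G \<in> ?coat E}"
      using coat_faces by blast
    then show ?thesis unfolding H(2)[symmetric] by (rule imageI)
  qed
  ultimately have
    "?C ` ?N = {F \<in> exposed_faces (polar K).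
       \<not> complete_normal_cone (polar K) (face_normal_cone (polar K) F)}"
    "?C ` {G \<in> ?N. \<exists>E\<in>exposed_faces K. G \<in> ?coat E} = ?C ` ?N"
    by blast+
  moreover have "{G \<in> faces K. ?C G = F} =
      {G \<in> faces K. exposed_closure K G = conjugate_face (polar K) F}"
    if "F \<in> exposed_faces (polar K)" for F
    using conjugate_face_eq_iff[OF _ that] by blast
  ultimately show ?thesis by simp
qed

end
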